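(* Let $(\mathfrak{g},[\,,\,]_{\cdot},[\,,\,]_{\circ},\triangleright)$ be a finite-dimensional real post-Lie algebra. Assume that the additive Lie algebra $(\mathfrak{g},[\,,\,]_{\cdot})$ is solvable, and let $\mathfrak{n}$ be the nilradical of $(\mathfrak{g},[\,,\,]_{\cdot})$. Then $\mathfrak{n}$ is an ideal of the post-Lie algebra.
   Context: A post-Lie algebra is a quadruple $(\mathfrak{g},[\,,\,]_{\cdot},[\,,\,]_{\circ},\triangleright)$ where $(\mathfrak{g},[\,,\,]_{\cdot})$ and $(\mathfrak{g},[\,,\,]_{\circ})$ are Lie algebras on the same finite-dimensional real vector space and $\triangleright:\mathfrak{g}\times\mathfrak{g}\to\mathfrak{g}$ is bilinear with, for all $x,y,z\in\mathfrak{g}$: $[x,y]_{\circ}-[x,y]_{\cdot}=x\triangleright y-y\triangleright x$; $x\triangleright[y,z]_{\cdot}=[x\triangleright y,z]_{\cdot}+[y,x\triangleright z]_{\cdot}$; $[x,y]_{\circ}\triangleright z=x\triangleright(y\triangleright z)-y\triangleright(x\triangleright z)$. An ideal of the post-Lie algebra is a vector subspace $\mathfrak{i}\subseteq\mathfrak{g}$ with $[\mathfrak{g},\mathfrak{i}]_{\cdot}\subseteq\mathfrak{i}$, $\mathfrak{g}\triangleright\mathfrak{i}\subseteq\mathfrak{i}$ and $\mathfrak{i}\triangleright\mathfrak{g}\subseteq\mathfrak{i}$. The nilradical of a finite-dimensional Lie algebra is its largest nilpotent ideal. *)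

theory Defs
  imports "HOL-Analysis.Analysis"
begin

text \<open>All Lie algebras and post-Lie algebras live on a whole type of class \<open>real_vector\<close>;
  this class contains no dimension restriction, and in particular admits the zero space.\<close>

definition finite_dimensional :: "'a::real_vector itself \<Rightarrow> bool" where
  "finite_dimensional _ \<longleftrightarrow> (\<exists>B::'a set. finite B \<and> span B = UNIV)"

locale lie_algebra =
  fixes br :: "'a::real_vector \<Rightarrow> 'a \<Rightarrow> 'a"
  assumes bilinear_br: "bilinear br"
    and br_self: "br x x = 0"
    and jacobi: "br x (br y z) + br y (br z x) + br z (br x y) = 0"

locale post_lie_algebra =
  dot: lie_algebra dot + circ: lie_algebra circ
  for dot :: "'a::real_vector \<Rightarrow> 'a \<Rightarrow> 'a"
    and circ :: "'a \<Rightarrow> 'a \<Rightarrow> 'a" +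
  fixes tri :: "'a \<Rightarrow> 'a \<Rightarrow> 'a"
  assumes finite_dim: "finite_dimensional TYPE('a)"
    and bilinear_tri: "bilinear tri"
    and circ_minus_dot: "circ x y - dot x y = tri x y - tri y x"
    and tri_dot: "tri x (dot y z) = dot (tri x y) z + dot y (tri x z)"
    and circ_tri: "tri (circ x y) z = tri x (tri y z) - tri y (tri x z)"

definition post_lie_ideal ::
  "('a::real_vector \<Rightarrow> 'a \<Rightarrow> 'a) \<Rightarrow> ('a \<Rightarrow> 'a \<Rightarrow> 'a) \<Rightarrow> 'a set \<Rightarrow> bool" where
  "post_lie_ideal dot tri I \<longleftrightarrow> subspace I \<and>
     (\<forall>x. \<forall>y\<in>I. dot x y \<in> I) \<and> (\<forall>x. \<forall>y\<in>I. tri x y \<in> I) \<and> (\<forall>x\<in>I. \<forall>y. tri x y \<in> I)"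

definition lie_ideal :: "('a::real_vector \<Rightarrow> 'a \<Rightarrow> 'a) \<Rightarrow> 'a set \<Rightarrow> bool" where
  "lie_ideal br I \<longleftrightarrow> subspace I \<and> (\<forall>x. \<forall>y\<in>I. br x y \<in> I)"

definition bracket_span ::
  "('a::real_vector \<Rightarrow> 'a \<Rightarrow> 'a) \<Rightarrow> 'a set \<Rightarrow> 'a set \<Rightarrow> 'a set" where
  "bracket_span br A B = span {br x y | x y. x \<in> A \<and> y \<in> B}"

primrec derived_series :: "('a::real_vector \<Rightarrow> 'a \<Rightarrow> 'a) \<Rightarrow> nat \<Rightarrow> 'a set" where
  "derived_series br 0 = UNIV"
| "derived_series br (Suc n) = bracket_span br (derived_series br n) (derived_series br n)"

definition solvable_lie :: "('a::real_vector \<Rightarrow> 'a \<Rightarrow> 'a) \<Rightarrow> bool" where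
  "solvable_lie br \<longleftrightarrow> (\<exists>n. derived_series br n = {0})"

text \<open>The lower central series of a subalgebra \<open>S\<close>, viewed as a Lie algebra in its own right:
  the brackets are with elements of \<open>S\<close>, not with elements of the ambient algebra.\<close>

primrec lower_central_series :: "('a::real_vector \<Rightarrow> 'a \<Rightarrow> 'a) \<Rightarrow> 'a set \<Rightarrow> nat \<Rightarrow> 'a set" where
  "lower_central_series br S 0 = S"
| "lower_central_series br S (Suc n) = bracket_span br S (lower_central_series br S n)"

definition nilpotent_lie_ideal :: "('a::real_vector \<Rightarrow> 'a \<Rightarrow> 'a) \<Rightarrow> 'a set \<Rightarrow> bool" where
  "nilpotent_lie_ideal br I \<longleftrightarrow> lie_ideal br I \<and> (\<exists>n. lower_central_series br I n = {0})"

text \<open>\<open>GREATEST\<close> is with respect to inclusion: the nilradical contains every nilpotent ideal.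
  Such an ideal exists (and is unique) in every finite-dimensional Lie algebra.\<close>

definition nilradical :: "('a::real_vector \<Rightarrow> 'a \<Rightarrow> 'a) \<Rightarrow> 'a set" where
  "nilradical br = (GREATEST I. nilpotent_lie_ideal br I)"

end

theory Submission
  imports Defs "HOL-Computational_Algebra.Polynomial"
begin

text \<open>
  The second post-Lie axiom says that every left multiplication \<open>tri x\<close> is a derivation of the
  additive Lie algebra. A derivation of a finite-dimensional solvable Lie algebra over the reals
  takes all its values in the nilradical. Hence every product \<open>tri x y\<close> lies in the nilradical,
  which makes both multiplicative closure conditions immediate.

  The statement on derivations is obtained from representation theory. In a representation of a
  Lie algebra on a finite-dimensional space, a chief factor is a pair of consecutive invariant
  subspaces, that is, a simple subquotient. For the adjoint representation, the elements that act
  as zero on all chief factors form the nilradical: descending through chief factors shows that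
  these elements form a nilpotent ideal, and a nilpotent ideal cannot act nontrivially on a simple
  subquotient. Given a derivation \<open>D\<close> of a solvable algebra \<open>g\<close>, the semidirect product
  of \<open>g\<close> with the line spanned by \<open>D\<close> is again solvable and acts on \<open>g\<close>. In this algebra
  \<open>D x\<close> is a bracket, so it suffices to know that brackets of a solvable algebra act as zero on
  chief factors: then \<open>D x\<close> belongs to the nilpotent ideal of those elements of \<open>g\<close> that vanish
  on the chief factors of the semidirect product.

  This last fact is the form of Lie's theorem that holds without extending the scalars. Its
  engine is Jacobson's lemma: in characteristic zero, a commutator \<open>[x, a]\<close> that commutes with
  \<open>a\<close> is nilpotent. Working downwards through the derived series, suppose that one derived ideal
  kills a chief factor, so that the preceding one, \<open>H\<close>, acts on it by commuting operators. By the
  lemma the brackets of \<open>H\<close> with arbitrary elements act nilpotently; their common kernel is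
  nonzero and invariant, hence the whole factor. So \<open>H\<close> acts centrally, and then the same
  argument applies to the brackets that span \<open>H\<close>.

  Quotient spaces are never formed: "zero on a factor" means that the larger subspace is mapped
  into the smaller one.
\<close>

section \<open>Finite-dimensional linear algebra\<close>

lemma dim_strict_mono:
  fixes U W :: "'a::real_vector set"
  assumes fd: "finite_dimensional TYPE('a)" and U: "subspace U" and "U \<subset> W"
  shows "dim U < dim W"
proof -
  obtain B :: "'a set" where B: "finite B" "span B = UNIV"
    using fd by (auto simp: finite_dimensional_def)
  obtain C where C: "C \<subseteq> U" "independent C" "U \<subseteq> span C" "card C = dim U"
    using basis_exists by blast
  obtain w where w: "w \<in> W" "w \<notin> U" using \<open>U \<subset> W\<close> by blast
  have "span C \<subseteq> U" using C(1) U by (simp add: span_minimal)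
  then have "w \<notin> span C" using w by blast
  then have ind: "independent (insert w C)" using C(2) by (simp add: independent_insertI)
  obtain E where E: "insert w C \<subseteq> E" "E \<subseteq> W" "independent E" "W \<subseteq> span E"
    using maximal_independent_subset_extend[of "insert w C" W] ind C(1) w(1) \<open>U \<subset> W\<close> by blast
  have finE: "finite E" using independent_span_bound[OF B(1) E(3)] B(2) by simp
  have "dim W = card E" using E by (simp add: dim_unique)
  moreover have "card C < card (insert w C)"
    using \<open>w \<notin> span C\<close> finE E(1) by (metis card_insert_disjoint finite_insert finite_subset lessI span_base)
  moreover have "card (insert w C) \<le> card E" using finE E(1) by (rule card_mono)
  ultimately show ?thesis using C(4) by simp
qed

definition poly_map :: "real poly \<Rightarrow> ('a::real_vector \<Rightarrow> 'a) \<Rightarrow> 'a \<Rightarrow> 'a" where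
  "poly_map p f = fold_coeffs (\<lambda>c g v. c *\<^sub>R v + f (g v)) p (\<lambda>_. 0)"

lemma poly_map_0 [simp]: "poly_map 0 f v = 0"
  by (simp add: poly_map_def)

lemma poly_map_pCons [simp]:
  assumes "linear f"
  shows "poly_map (pCons c p) f v = c *\<^sub>R v + f (poly_map p f v)"
proof (cases "p = 0 \<and> c = 0")
  case True
  then show ?thesis using linear_0[OF assms] by simp
next
  case False
  then show ?thesis by (auto simp: poly_map_def)
qed

lemma poly_map_add:
  assumes "linear f"
  shows "poly_map (p + q) f v = poly_map p f v + poly_map q f v"
  using assms
  by (induction p q rule: poly_induct2) (simp_all add: linear_add scaleR_add_left)

lemma poly_map_smult:
  assumes "linear f"
  shows "poly_map (smult c p) f v = c *\<^sub>R poly_map p f v"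
  using assms
  by (induction p) (simp_all add: linear_scale scaleR_add_right)

lemma poly_map_mult:
  assumes "linear f"
  shows "poly_map (p * q) f v = poly_map p f (poly_map q f v)"
  using assms
  by (induction p) (simp_all add: poly_map_add poly_map_smult)

lemma linear_poly_map:
  assumes "linear f"
  shows "linear (poly_map p f)"
proof (induction p)
  case 0
  then show ?case by (simp add: linear_iff)
next
  case (pCons c p)
  show ?case
    by (rule linearI)
      (simp_all add: assms linear_add[OF assms] linear_scale[OF assms] linear_add[OF pCons(2)]
        linear_scale[OF pCons(2)] scaleR_add_right)
qed

lemma poly_map_monom:
  assumes "linear f"
  shows "poly_map (monom c n) f v = c *\<^sub>R (f ^^ n) v"
  using assms
  by (induction n) (simp_all add: monom_0 monom_Suc linear_0 linear_scale)

text \<open>The degree bound lets a vanishing combination be recognised as a nonzero polynomial once the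
  monomial of degree \<open>n\<close> is subtracted.\<close>

lemma span_orbit_poly_map:
  assumes f: "linear f" and w: "w \<in> span ((\<lambda>i. (f ^^ i) v) ` {..<n})"
  shows "\<exists>p. (\<forall>i\<ge>n. coeff p i = 0) \<and> w = poly_map p f v"
  using w
proof (induction rule: span_induct_alt)
  case base
  show ?case by (rule exI[of _ 0]) simp
next
  case (step c x y)
  then obtain i p where "i < n" "x = (f ^^ i) v" "\<forall>i\<ge>n. coeff p i = 0" "y = poly_map p f v"
    by auto
  then show ?case using f
    by (intro exI[of _ "monom c i + p"]) (auto simp: poly_map_add poly_map_monom)
qed

lemma vector_annihilator:
  fixes f :: "'a::real_vector \<Rightarrow> 'a"
  assumes fd: "finite_dimensional TYPE('a)" and f: "linear f"
  shows "\<exists>p. p \<noteq> 0 \<and> poly_map p f v = 0"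
proof -
  obtain B :: "'a set" where B: "finite B" "span B = UNIV"
    using fd by (auto simp: finite_dimensional_def)
  define S where "S n = (\<lambda>i. (f ^^ i) v) ` {..<n}" for n
  \<comment> \<open>Otherwise the orbit of \<open>v\<close> would contain arbitrarily large independent sets.\<close>
  have "\<exists>n. (f ^^ n) v \<in> span (S n)"
  proof (rule ccontr)
    assume no: "\<nexists>n. (f ^^ n) v \<in> span (S n)"
    have S_Suc: "S (Suc n) = insert ((f ^^ n) v) (S n)" for n
      by (simp add: S_def lessThan_Suc)
    have "independent (S n) \<and> card (S n) = n" for n
    proof (induction n)
      case 0
      then show ?case by (simp add: S_def independent_empty)
    next
      case (Suc n)
      moreover have "finite (S n)" by (simp add: S_def)
      moreover have "(f ^^ n) v \<notin> span (S n)" using no by blast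
      ultimately show ?case unfolding S_Suc
        by (auto simp: independent_insertI card_insert_if span_base)
    qed
    then have "Suc (card B) \<le> card B"
      using independent_span_bound[OF B(1), of "S (Suc (card B))"] B(2) by auto
    then show False by simp
  qed
  then obtain n where "(f ^^ n) v \<in> span (S n)" by blast
  then obtain p where p: "\<forall>i\<ge>n. coeff p i = 0" "(f ^^ n) v = poly_map p f v"
    using span_orbit_poly_map[OF f] unfolding S_def by blast
  have "coeff (monom (-1) n + p) n \<noteq> 0" using p(1) by simp
  then have "monom (-1) n + p \<noteq> 0" by (metis coeff_0)
  moreover have "poly_map (monom (-1) n + p) f v = 0"
    using p(2) f by (simp add: poly_map_add poly_map_monom)
  ultimately show ?thesis by blast
qed

text \<open>Annihilators of the vectors of a finite spanning set are multiplied together; this replaces a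
  dimension count in the space of endomorphisms.\<close>

lemma annihilating_polynomial:
  fixes f :: "'a::real_vector \<Rightarrow> 'a"
  assumes fd: "finite_dimensional TYPE('a)" and f: "linear f"
  shows "\<exists>p. p \<noteq> 0 \<and> (\<forall>v. poly_map p f v = 0)"
proof -
  have "\<exists>p. p \<noteq> 0 \<and> (\<forall>v\<in>B. poly_map p f v = 0)" if "finite B" for B
    using that
  proof (induction B)
    case empty
    show ?case by (rule exI[of _ 1]) simp
  next
    case (insert b B)
    then obtain p q where p: "p \<noteq> 0" "\<forall>v\<in>B. poly_map p f v = 0"
      and q: "q \<noteq> 0" "poly_map q f b = 0"
      using vector_annihilator[OF fd f] by blast
    have "poly_map (q * p) f v = 0" if "v \<in> insert b B" for v
      using that p q poly_map_mult[OF f, of p q b] poly_map_mult[OF f, of q p v]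
        linear_0[OF linear_poly_map[OF f]]
      by (auto simp: mult.commute)
    then show ?case using p q by (intro exI[of _ "q * p"]) auto
  qed
  moreover obtain B :: "'a set" where B: "finite B" "span B = UNIV"
    using fd by (auto simp: finite_dimensional_def)
  ultimately obtain p where p: "p \<noteq> 0" "\<forall>v\<in>B. poly_map p f v = 0" by blast
  have "poly_map p f v = 0" for v
    by (rule linear_eq_0_on_span[OF linear_poly_map[OF f], of B]) (use p B in auto)
  with p show ?thesis by blast
qed

section \<open>Commutators that are nilpotent on a factor\<close>

lemma poly_map_mem:
  assumes f: "linear f" and W: "subspace W" "\<And>w. w \<in> W \<Longrightarrow> f w \<in> W" "w \<in> W"
  shows "poly_map p f w \<in> W"
  using assms by (induction p) (simp_all add: subspace_0 subspace_add subspace_scale)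

lemma funpow_mem:
  assumes "\<And>w. w \<in> W \<Longrightarrow> f w \<in> W" "w \<in> W"
  shows "(f ^^ n) w \<in> W"
  using assms by (induction n) auto

text \<open>The operators are considered on \<open>W\<close> modulo \<open>U\<close>, where the commutator \<open>b\<close> of \<open>x\<close> and
  \<open>a\<close> commutes with \<open>a\<close>. The aim is Jacobson's lemma: some power of \<open>b\<close> maps \<open>W\<close> into
  \<open>U\<close>.\<close>

locale factor_commutator =
  fixes x a b :: "'v::real_vector \<Rightarrow> 'v" and U W :: "'v set"
  assumes fd: "finite_dimensional TYPE('v)"
    and x: "linear x" and a: "linear a"
    and b: "\<And>v. b v = x (a v) - a (x v)"
    and U: "subspace U" and W: "subspace W"
    and xU: "\<And>u. u \<in> U \<Longrightarrow> x u \<in> U" and aU: "\<And>u. u \<in> U \<Longrightarrow> a u \<in> U"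
    and xW: "\<And>w. w \<in> W \<Longrightarrow> x w \<in> W" and aW: "\<And>w. w \<in> W \<Longrightarrow> a w \<in> W"
    and comm: "\<And>w. w \<in> W \<Longrightarrow> a (b w) - b (a w) \<in> U"
begin

lemma linear_b: "linear b"
  using x a by (auto simp: linear_iff b algebra_simps)

lemma bU: "u \<in> U \<Longrightarrow> b u \<in> U"
  by (simp add: b xU aU U subspace_diff)

lemma bW: "w \<in> W \<Longrightarrow> b w \<in> W"
  by (simp add: b xW aW W subspace_diff)

lemma b_poly_commute:
  assumes "w \<in> W"
  shows "b (poly_map p a w) - poly_map p a (b w) \<in> U"
proof (induction p)
  case 0
  then show ?case using U by (simp add: linear_0[OF linear_b] subspace_0)
next
  case (pCons c p)
  let ?q = "poly_map p a"
  have "b (poly_map (pCons c p) a w) - poly_map (pCons c p) a (b w)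
      = a (b (?q w) - ?q (b w)) - (a (b (?q w)) - b (a (?q w)))"
    using a linear_b by (simp add: linear_add linear_scale linear_diff)
  then show ?case
    using pCons aU comm[OF poly_map_mem[OF a W aW assms]] U by (simp add: subspace_diff)
qed

lemma b_power_poly_commute:
  assumes "w \<in> W"
  shows "(b ^^ n) (poly_map p a w) - poly_map p a ((b ^^ n) w) \<in> U"
proof (induction n)
  case 0
  then show ?case using U by (simp add: subspace_0)
next
  case (Suc n)
  let ?w = "(b ^^ n) w"
  have w: "?w \<in> W" by (rule funpow_mem[OF bW assms])
  have "(b ^^ Suc n) (poly_map p a w) - poly_map p a ((b ^^ Suc n) w)
      = b ((b ^^ n) (poly_map p a w) - poly_map p a ?w) + (b (poly_map p a ?w) - poly_map p a (b ?w))"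
    using linear_b by (simp add: linear_diff)
  then show ?case
    using subspace_add[OF U bU[OF Suc] b_poly_commute[OF w]] by metis
qed

text \<open>Since \<open>b\<close> commutes with \<open>a\<close>, the inner derivation by \<open>x\<close> acts on polynomials in \<open>a\<close> like
  differentiation followed by multiplication with \<open>b\<close>.\<close>

lemma commutator_poly:
  assumes "w \<in> W"
  shows "x (poly_map p a w) - poly_map p a (x w) - poly_map (pderiv p) a (b w) \<in> U"
proof (induction p)
  case 0
  then show ?case using U by (simp add: linear_0[OF x] subspace_0)
next
  case (pCons c p)
  let ?q = "poly_map p a" and ?d = "poly_map (pderiv p) a"
  have "x (poly_map (pCons c p) a w) - poly_map (pCons c p) a (x w)
        - poly_map (pderiv (pCons c p)) a (b w)
      = a (x (?q w) - ?q (x w) - ?d (b w)) + (b (?q w) - ?q (b w))"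
    using a x by (simp add: linear_add linear_scale linear_diff pderiv_pCons poly_map_add b[of "?q w"])
  then show ?case
    using aU[OF pCons(2)] b_poly_commute[OF assms] U by (simp add: subspace_add)
qed

text \<open>Commute \<open>x\<close> through the relation \<open>q(a) b^m = 0\<close> (modulo \<open>U\<close>), applied to \<open>w\<close>. Besides
  the wanted \<open>q'(a) b^(m+1) w\<close> this leaves \<open>q(a) x b^m w\<close>, which dies after a further
  multiplication by \<open>b^m\<close> because the relation also applies to \<open>x b^m w\<close>. This is why the
  exponent grows to \<open>2 * m + 1\<close>.\<close>

lemma derivative_step:
  assumes kill: "\<And>w. w \<in> W \<Longrightarrow> poly_map q a ((b ^^ m) w) \<in> U" and w: "w \<in> W"
  shows "poly_map (pderiv q) a ((b ^^ (2 * m + 1)) w) \<in> U"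
proof -
  let ?q = "poly_map q a" and ?d = "poly_map (pderiv q) a" and ?v = "(b ^^ m) w"
  have v: "?v \<in> W" by (rule funpow_mem[OF bW w])
  have bv: "b ?v \<in> W" by (rule bW[OF v])
  have lin: "linear (b ^^ m)"
    by (induction m) (simp_all only: funpow.simps linear_id linear_compose linear_b)
  have bmU: "(b ^^ m) u \<in> U" if "u \<in> U" for u by (rule funpow_mem[OF bU that])
  have "x (?q ?v) \<in> U" using xU kill w by blast
  moreover have "x (?q ?v) - ?q (x ?v) - ?d (b ?v) \<in> U" by (rule commutator_poly[OF v])
  ultimately have "x (?q ?v) - (x (?q ?v) - ?q (x ?v) - ?d (b ?v)) \<in> U"
    using U by (rule_tac subspace_diff)
  then have "(b ^^ m) (?q (x ?v) + ?d (b ?v)) \<in> U"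
    by (intro bmU) (simp add: add.commute)
  then have 1: "(b ^^ m) (?q (x ?v)) + (b ^^ m) (?d (b ?v)) \<in> U"
    using linear_add[OF lin] by simp
  have "(b ^^ m) (?q (x ?v)) - ?q ((b ^^ m) (x ?v)) \<in> U"
    by (rule b_power_poly_commute[OF xW[OF v]])
  from subspace_add[OF U this kill[OF xW[OF v]]]
  have "(b ^^ m) (?q (x ?v)) \<in> U" by simp
  from subspace_diff[OF U 1 this] have 2: "(b ^^ m) (?d (b ?v)) \<in> U" by simp
  have "(b ^^ m) (?d (b ?v)) - ?d ((b ^^ m) (b ?v)) \<in> U"
    by (rule b_power_poly_commute[OF bv])
  from subspace_diff[OF U 2 this] have "?d ((b ^^ m) (b ?v)) \<in> U" by simp
  moreover have "(b ^^ m) (b ?v) = (b ^^ (2 * m + 1)) w"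
    by (simp add: funpow_add mult_2 funpow_swap1)
  ultimately show ?thesis by simp
qed

text \<open>Differentiating repeatedly reduces \<open>q\<close> to a constant. The constant is nonzero because the
  field has characteristic zero, so a power of \<open>b\<close> alone vanishes.\<close>

lemma nilpotent_of_annihilator:
  assumes "q \<noteq> 0" and "\<And>w. w \<in> W \<Longrightarrow> poly_map q a ((b ^^ m) w) \<in> U"
  shows "\<exists>k. \<forall>w\<in>W. (b ^^ k) w \<in> U"
  using assms
proof (induction "degree q" arbitrary: q m rule: less_induct)
  case less
  show ?case
  proof (cases "degree q = 0")
    case True
    then obtain c where c: "q = [:c:]" by (metis degree_eq_zeroE)
    with less.prems(1) have "c \<noteq> 0" by simp
    have "(b ^^ m) w \<in> U" if "w \<in> W" for w
    proof -
      have "c *\<^sub>R (b ^^ m) w \<in> U" using less.prems(2)[OF that] a c by (simp add: linear_0)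
      then have "(1 / c) *\<^sub>R c *\<^sub>R (b ^^ m) w \<in> U" using U by (simp only: subspace_scale)
      then show ?thesis using \<open>c \<noteq> 0\<close> by simp
    qed
    then show ?thesis by blast
  next
    case False
    then have "pderiv q \<noteq> 0" by (simp add: pderiv_eq_0_iff)
    moreover have "degree (pderiv q) < degree q" using False by (simp add: degree_pderiv)
    ultimately show ?thesis
      using less.hyps[of "pderiv q" "2 * m + 1"] derivative_step[OF less.prems(2)] by blast
  qed
qed

lemma commutator_nilpotent: "\<exists>k. \<forall>w\<in>W. (b ^^ k) w \<in> U"
proof -
  obtain p where "p \<noteq> 0" "\<And>v. poly_map p a v = 0"
    using annihilating_polynomial[OF fd a] by blast
  then show ?thesis
    using nilpotent_of_annihilator[of p 0] U by (simp add: subspace_0)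
qed

end

lemma nilpotent_kernel:
  assumes nil: "\<forall>w\<in>W. (b ^^ k) w \<in> U" and bM: "\<And>w. w \<in> M \<Longrightarrow> b w \<in> M"
    and "U \<subset> M" "M \<subseteq> W"
  shows "\<exists>w\<in>M. w \<notin> U \<and> b w \<in> U"
proof (rule ccontr)
  assume no: "\<not> ?thesis"
  obtain w where w: "w \<in> M" "w \<notin> U" using \<open>U \<subset> M\<close> by blast
  have "(b ^^ n) w \<in> M \<and> (b ^^ n) w \<notin> U" for n
    by (induction n) (use w no bM in auto)
  then show False using nil w \<open>M \<subseteq> W\<close> by blast
qed

section \<open>Representations and chief factors\<close>

context lie_algebra
begin

lemma linear_br_right: "linear (br x)"
  and linear_br_left: "linear (\<lambda>x. br x y)"
  using bilinear_br by (simp_all add: bilinear_def)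

lemma br_skew: "br x y = - br y x"
proof -
  have "br (x + y) (x + y) = (br x x + br x y) + (br y x + br y y)"
    by (simp only: bilinear_ladd[OF bilinear_br] bilinear_radd[OF bilinear_br] ac_simps)
  then have "br x y + br y x = 0" by (simp add: br_self)
  then show ?thesis by (simp add: eq_neg_iff_add_eq_0)
qed

text \<open>The Jacobi identity in the form that adjoint maps are derivations.\<close>

lemma br_derivation: "br x (br y z) = br (br x y) z + br y (br x z)"
proof -
  have "br y (br z x) = - br y (br x z)"
    using linear_neg[OF linear_br_right, of y "br x z"] br_skew[of z x] by simp
  moreover have "br z (br x y) = - br (br x y) z" by (rule br_skew)
  ultimately show ?thesis using jacobi[of x y z] by (simp add: algebra_simps)
qed

lemma subspace_derived_series: "subspace (derived_series br n)"
  by (cases n) (simp_all add: bracket_span_def)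

lemma br_mem_derived_series:
  "u \<in> derived_series br n \<Longrightarrow> v \<in> derived_series br n \<Longrightarrow> br u v \<in> derived_series br (Suc n)"
  by (auto simp: bracket_span_def intro!: span_base)

lemma derived_series_ideal:
  "y \<in> derived_series br n \<Longrightarrow> br x y \<in> derived_series br n"
proof (induction n arbitrary: x y)
  case 0
  show ?case by simp
next
  case (Suc n)
  have "y \<in> span {br u v |u v. u \<in> derived_series br n \<and> v \<in> derived_series br n}"
    using Suc.prems by (simp add: bracket_span_def)
  then show ?case
  proof (induction rule: span_induct_alt)
    case base
    show ?case
      using linear_0[OF linear_br_right] subspace_0[OF subspace_derived_series, of "Suc n"] by simp
  next
    case (step c z y)
    then obtain u v where z: "z = br u v" and uv: "u \<in> derived_series br n" "v \<in> derived_series br n"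
      by auto
    have "br x z \<in> derived_series br (Suc n)"
      unfolding z br_derivation[of x u v]
      by (intro subspace_add[OF subspace_derived_series] br_mem_derived_series Suc.IH uv)
    then show ?case
      using step(2) subspace_derived_series[of "Suc n"]
      by (simp add: linear_add[OF linear_br_right] linear_scale[OF linear_br_right]
          subspace_add subspace_scale del: derived_series.simps)
  qed
qed

lemma derived_series_Suc_subset: "derived_series br (Suc n) \<subseteq> derived_series br n"
  unfolding derived_series.simps bracket_span_def
  by (rule span_minimal[OF _ subspace_derived_series]) (auto intro: derived_series_ideal)

end

locale lie_representation = lie_algebra br
  for br :: "'l::real_vector \<Rightarrow> 'l \<Rightarrow> 'l" +
  fixes act :: "'l \<Rightarrow> 'v::real_vector \<Rightarrow> 'v"
  assumes fd: "finite_dimensional TYPE('v)"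
    and bilinear_act: "bilinear act"
    and act_br: "act (br x y) v = act x (act y v) - act y (act x v)"
begin

lemma linear_act: "linear (act x)"
  and linear_act_left: "linear (\<lambda>x. act x v)"
  using bilinear_act by (simp_all add: bilinear_def)

definition invariant :: "'v set \<Rightarrow> bool" where
  "invariant W \<longleftrightarrow> subspace W \<and> (\<forall>x. \<forall>w\<in>W. act x w \<in> W)"

definition chief_factor :: "'v set \<Rightarrow> 'v set \<Rightarrow> bool" where
  "chief_factor U W \<longleftrightarrow> invariant U \<and> invariant W \<and> U \<subset> W \<and>
     (\<forall>K. invariant K \<longrightarrow> U \<subseteq> K \<longrightarrow> K \<subseteq> W \<longrightarrow> K = U \<or> K = W)"

definition kills :: "'l \<Rightarrow> 'v set \<Rightarrow> 'v set \<Rightarrow> bool" where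
  "kills x U W \<longleftrightarrow> (\<forall>w\<in>W. act x w \<in> U)"

definition chief_kernel :: "'l set" where
  "chief_kernel = {x. \<forall>U W. chief_factor U W \<longrightarrow> kills x U W}"

text \<open>A proper invariant subspace of maximal dimension in \<open>W\<close> is a suitable lower term.\<close>

lemma exists_chief_factor:
  assumes W: "invariant W" "W \<noteq> {0}"
  shows "\<exists>U. chief_factor U W"
proof -
  let ?P = "\<lambda>U. invariant U \<and> U \<subset> W"
  have "invariant {0}"
    using linear_0[OF linear_act] by (simp add: invariant_def subspace_def)
  moreover have "{0} \<subset> W" using W by (auto simp: invariant_def subspace_0)
  moreover have "\<forall>U. ?P U \<longrightarrow> dim U < dim W"
    using dim_strict_mono[OF fd, of _ W] unfolding invariant_def by blast
  ultimately have "\<exists>U. ?P U \<and> (\<forall>K. ?P K \<longrightarrow> dim K \<le> dim U)"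
    by (intro ex_has_greatest_nat[of ?P "{0}" dim "dim W"]) auto
  then obtain U where U: "?P U" and max: "\<And>K. ?P K \<Longrightarrow> dim K \<le> dim U" by metis
  have "K = U \<or> K = W" if "invariant K" "U \<subseteq> K" "K \<subseteq> W" for K
    using that max[of K] U dim_strict_mono[OF fd, of U K] by (fastforce simp: invariant_def)
  then show ?thesis using U W by (auto simp: chief_factor_def)
qed

lemma subspace_killers:
  assumes "subspace U"
  shows "subspace {x. kills x U W}"
  using assms
  by (auto simp: subspace_def kills_def linear_0[OF linear_act_left]
      linear_add[OF linear_act_left] linear_scale[OF linear_act_left])

lemma chief_kernel_ideal: "lie_ideal br chief_kernel"
proof -
  have "chief_kernel = \<Inter>{{x. kills x U W} |U W. chief_factor U W}"
    by (auto simp: chief_kernel_def)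
  moreover have "subspace (\<Inter>{{x. kills x U W} |U W. chief_factor U W})"
    by (rule subspace_Inter) (auto simp: chief_factor_def invariant_def intro: subspace_killers)
  moreover have "br x y \<in> chief_kernel" if "y \<in> chief_kernel" for x y
  proof -
    have "kills (br x y) U W" if UW: "chief_factor U W" for U W
    proof -
      have "kills y U W" using \<open>y \<in> chief_kernel\<close> UW by (simp add: chief_kernel_def)
      then show ?thesis
        using UW by (auto simp: kills_def act_br chief_factor_def invariant_def intro!: subspace_diff)
    qed
    then show ?thesis by (simp add: chief_kernel_def)
  qed
  ultimately show ?thesis by (simp add: lie_ideal_def)
qed

text \<open>If \<open>J\<close> maps the upper term of every chief factor into the lower term, each bracketing with
  \<open>J\<close> pushes the lower central series from an invariant subspace into a strictly smaller one.
  The bracket \<open>br'\<close> lives on the space acted upon and is distinct from the acting algebra,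
  because the chief factors will be those of a larger algebra than the one whose nilpotency is
  wanted.\<close>

lemma lower_central_series_reaches_zero:
  fixes br' :: "'v \<Rightarrow> 'v \<Rightarrow> 'v"
  assumes kill: "\<And>U W x w. chief_factor U W \<Longrightarrow> x \<in> J \<Longrightarrow> w \<in> W \<Longrightarrow> br' x w \<in> U"
  shows "\<exists>n. lower_central_series br' J n \<subseteq> {0}"
proof -
  have "\<exists>m. lower_central_series br' J m \<subseteq> {0}"
    if "invariant W" "lower_central_series br' J n \<subseteq> W" for W n
    using that
  proof (induction "dim W" arbitrary: W n rule: less_induct)
    case less
    show ?case
    proof (cases "W = {0}")
      case True
      then show ?thesis using less.prems by blast
    next
      case False
      then obtain U where U: "chief_factor U W" using exists_chief_factor less.prems by blast
      then have inv: "invariant U" "U \<subset> W" by (auto simp: chief_factor_def)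
      then have "subspace U" by (simp add: invariant_def)
      then have "lower_central_series br' J (Suc n) \<subseteq> U"
        using kill[OF U] less.prems(2) unfolding lower_central_series.simps bracket_span_def
        by (intro span_minimal) auto
      then show ?thesis
        using less.hyps[of U "Suc n"] inv dim_strict_mono[OF fd \<open>subspace U\<close>] by blast
    qed
  qed
  from this[of UNIV 0] show ?thesis by (simp add: invariant_def)
qed

text \<open>When \<open>N\<close> is stable under brackets up to elements that act as zero, the vectors that \<open>N\<close> maps
  into \<open>U\<close> form an invariant subspace between \<open>U\<close> and \<open>W\<close>, so they form one of the two.\<close>

lemma kernel_dichotomy:
  assumes UW: "chief_factor U W"
    and ideal: "\<And>y z. y \<in> N \<Longrightarrow> br y z \<in> N \<or> kills (br y z) U W"
  shows "(\<forall>y\<in>N. kills y U W) \<or> (\<forall>w\<in>W - U. \<exists>y\<in>N. act y w \<notin> U)"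
proof -
  let ?K = "{w \<in> W. \<forall>y\<in>N. act y w \<in> U}"
  have U: "subspace U" "\<And>x w. w \<in> U \<Longrightarrow> act x w \<in> U"
    and W: "subspace W" "\<And>x w. w \<in> W \<Longrightarrow> act x w \<in> W" and sub: "U \<subseteq> W"
    using UW by (auto simp: chief_factor_def invariant_def)
  have "act y (act z w) \<in> U" if "w \<in> ?K" "y \<in> N" for y z w
  proof -
    have "act (br y z) w \<in> U" using ideal[OF that(2), of z] that by (auto simp: kills_def)
    moreover have "act z (act y w) \<in> U" using that U by blast
    ultimately have "act (br y z) w + act z (act y w) \<in> U" using U by (simp add: subspace_add)
    then show ?thesis by (simp add: act_br)
  qed
  moreover have "subspace ?K"
    using U W by (auto simp: subspace_def linear_0[OF linear_act] linear_add[OF linear_act]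
        linear_scale[OF linear_act])
  ultimately have "invariant ?K" using W by (auto simp: invariant_def)
  moreover have "U \<subseteq> ?K" using U sub by blast
  ultimately have "?K = U \<or> ?K = W" using UW by (auto simp: chief_factor_def)
  then show ?thesis by (auto simp: kills_def)
qed

text \<open>Engel's theorem in the commuting case. Take an \<open>N\<close>-stable subspace \<open>M\<close> strictly above \<open>U\<close>
  of minimal dimension. The kernel of a single element of \<open>N\<close> on the quotient of \<open>M\<close> is nonzero
  by nilpotency and \<open>N\<close>-stable by commutativity, hence is everything by minimality.\<close>

lemma commuting_nilpotents_kernel:
  assumes UW: "chief_factor U W"
    and nil: "\<And>y. y \<in> N \<Longrightarrow> \<exists>k. \<forall>w\<in>W. (act y ^^ k) w \<in> U"
    and comm: "\<And>y z. y \<in> N \<Longrightarrow> z \<in> N \<Longrightarrow> kills (br y z) U W"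
  shows "\<exists>w\<in>W - U. \<forall>y\<in>N. act y w \<in> U"
proof -
  have U: "subspace U" "\<And>x w. w \<in> U \<Longrightarrow> act x w \<in> U"
    and W: "subspace W" "\<And>x w. w \<in> W \<Longrightarrow> act x w \<in> W" and sub: "U \<subset> W"
    using UW by (auto simp: chief_factor_def invariant_def)
  let ?P = "\<lambda>M. subspace M \<and> U \<subset> M \<and> M \<subseteq> W \<and> (\<forall>y\<in>N. \<forall>w\<in>M. act y w \<in> M)"
  have "?P W" using W sub by blast
  then have "\<exists>M. ?P M \<and> (\<forall>K. ?P K \<longrightarrow> dim M \<le> dim K)"
    by (rule ex_has_least_nat)
  then obtain M where M: "?P M" and min: "\<And>K. ?P K \<Longrightarrow> dim M \<le> dim K" by metis
  have "act y w \<in> U" if y: "y \<in> N" and w: "w \<in> M" for y w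
  proof -
    let ?K = "{w \<in> M. act y w \<in> U}"
    obtain k where "\<forall>w\<in>W. (act y ^^ k) w \<in> U" using nil[OF y] by blast
    then have ex: "\<exists>w\<in>M. w \<notin> U \<and> act y w \<in> U"
      by (rule nilpotent_kernel) (use M y in auto)
    have "subspace ?K"
      using U M by (auto simp: subspace_def linear_0[OF linear_act] linear_add[OF linear_act]
          linear_scale[OF linear_act])
    moreover have "U \<subset> ?K" using ex U M by blast
    moreover have "act y (act z w) \<in> U" if "z \<in> N" "w \<in> ?K" for z w
    proof -
      have "act (br y z) w \<in> U" using comm[OF y that(1)] that M by (auto simp: kills_def)
      moreover have "act z (act y w) \<in> U" using that U by blast
      ultimately have "act (br y z) w + act z (act y w) \<in> U" using U by (simp add: subspace_add)
      then show ?thesis by (simp add: act_br)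
    qed
    ultimately have "?P ?K" using M by auto
    then have "dim M \<le> dim ?K" by (rule min)
    then have "\<not> ?K \<subset> M" using dim_strict_mono[OF fd \<open>subspace ?K\<close>] by fastforce
    then show ?thesis using w by blast
  qed
  then show ?thesis using M by blast
qed

lemma commuting_nilpotent_ideal_kills:
  assumes "chief_factor U W"
    and "\<And>y. y \<in> N \<Longrightarrow> \<exists>k. \<forall>w\<in>W. (act y ^^ k) w \<in> U"
    and "\<And>y z. y \<in> N \<Longrightarrow> z \<in> N \<Longrightarrow> kills (br y z) U W"
    and "\<And>y z. y \<in> N \<Longrightarrow> br y z \<in> N \<or> kills (br y z) U W"
    and "y \<in> N"
  shows "kills y U W"
proof -
  have "\<exists>w\<in>W - U. \<forall>y\<in>N. act y w \<in> U"
    using assms(1-3) by (rule commuting_nilpotents_kernel)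
  moreover have "(\<forall>y\<in>N. kills y U W) \<or> (\<forall>w\<in>W - U. \<exists>y\<in>N. act y w \<notin> U)"
    using assms(1,4) by (rule kernel_dichotomy)
  ultimately show ?thesis using \<open>y \<in> N\<close> by blast
qed

lemma bracket_nilpotent_on_factor:
  assumes UW: "chief_factor U W" and comm: "kills (br a (br x a)) U W"
  shows "\<exists>k. \<forall>w\<in>W. (act (br x a) ^^ k) w \<in> U"
proof -
  interpret factor_commutator "act x" "act a" "act (br x a)" U W
  proof (rule factor_commutator.intro)
    show "act a (act (br x a) w) - act (br x a) (act a w) \<in> U" if "w \<in> W" for w
      using comm that by (simp add: kills_def flip: act_br)
    show "act (br x a) v = act x (act a v) - act a (act x v)" for v by (rule act_br)
  qed (use UW in \<open>auto simp: fd linear_act chief_factor_def invariant_def\<close>)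
  show ?thesis by (rule commutator_nilpotent)
qed

text \<open>Two applications of Jacobson's lemma. With \<open>H\<close> the derived ideal in question, the brackets
  \<open>[x, a]\<close> with \<open>a\<close> in \<open>H\<close> commute with \<open>a\<close> because the next derived ideal acts as zero;
  so they act as zero, and \<open>H\<close> acts centrally. But \<open>H\<close> is itself spanned by brackets, here one
  needs its index to be positive, and being central these are again nilpotent.\<close>

lemma derived_series_kills_step:
  assumes UW: "chief_factor U W"
    and kill: "\<And>h. h \<in> derived_series br (Suc (Suc n)) \<Longrightarrow> kills h U W"
    and h: "h \<in> derived_series br (Suc n)"
  shows "kills h U W"
proof -
  let ?G = "derived_series br n" and ?H = "derived_series br (Suc n)"
  have U: "subspace U" using UW by (simp add: chief_factor_def invariant_def)
  have HH: "kills (br y z) U W" if "y \<in> ?H" "z \<in> ?H" for y z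
    using that by (intro kill br_mem_derived_series)
  let ?N = "{br x a |x a. a \<in> ?H}"
  have NH: "?N \<subseteq> ?H" using derived_series_ideal by blast
  have central: "kills (br x a) U W" if "a \<in> ?H" for x a
  proof (rule commuting_nilpotent_ideal_kills[OF UW, of ?N])
    show "\<exists>k. \<forall>w\<in>W. (act y ^^ k) w \<in> U" if "y \<in> ?N" for y
      using that bracket_nilpotent_on_factor[OF UW] HH derived_series_ideal by blast
    show "kills (br y z) U W" if "y \<in> ?N" "z \<in> ?N" for y z
      using that NH HH by blast
    show "br y z \<in> ?N \<or> kills (br y z) U W" if "y \<in> ?N" for y z
    proof -
      have "br y z = br (- z) y"
        using br_skew[of y z] linear_neg[OF linear_br_left[of y], of z] by simp
      then show ?thesis using that NH by blast
    qed
    show "br x a \<in> ?N" using that by blast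
  qed
  have bracket: "kills (br x y) U W" if "x \<in> ?G" "y \<in> ?G" for x y
  proof (rule commuting_nilpotent_ideal_kills[OF UW, of "{br x y}"])
    have H: "br x y \<in> ?H" using that by (rule br_mem_derived_series)
    have "kills (br y (br x y)) U W" by (rule central[OF H])
    then show "\<exists>k. \<forall>w\<in>W. (act b ^^ k) w \<in> U" if "b \<in> {br x y}" for b
      using that bracket_nilpotent_on_factor[OF UW] by blast
    show "kills (br b c) U W" if "b \<in> {br x y}" "c \<in> {br x y}" for b c
      using that HH H by blast
    show "br b z \<in> {br x y} \<or> kills (br b z) U W" if "b \<in> {br x y}" for b z
    proof -
      have "kills (- br z b) U W"
        using central[OF H, of z] subspace_neg[OF subspace_killers[OF U]] that by auto
      then show ?thesis using br_skew[of b z] by simp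
    qed
  qed simp
  have "?H \<subseteq> {h. kills h U W}"
    unfolding derived_series.simps bracket_span_def
    by (rule span_minimal[OF _ subspace_killers[OF U]]) (use bracket in auto)
  then show ?thesis using h by blast
qed

text \<open>The descent stops at the first derived ideal, which is spanned by all brackets.\<close>

theorem solvable_bracket_in_chief_kernel:
  assumes "solvable_lie br"
  shows "br x y \<in> chief_kernel"
proof -
  obtain n where n: "derived_series br n = {0}" using assms by (auto simp: solvable_lie_def)
  have "kills (br x y) U W" if UW: "chief_factor U W" for U W
  proof -
    have U: "subspace U" using UW by (simp add: chief_factor_def invariant_def)
    have "kills 0 U W"
      using subspace_0[OF U] by (simp add: kills_def linear_0[OF linear_act_left])
    then have "\<forall>h\<in>derived_series br (Suc n). kills h U W"
      using derived_series_Suc_subset[of n] unfolding n by blast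
    then have "\<forall>h\<in>derived_series br (Suc 0). kills h U W"
    proof (induction n)
      case (Suc n)
      then show ?case using derived_series_kills_step[OF UW] by blast
    qed
    moreover have "br x y \<in> derived_series br (Suc 0)"
      by (simp add: br_mem_derived_series del: derived_series.simps(2))
    ultimately show ?thesis by blast
  qed
  then show ?thesis by (simp add: chief_kernel_def)
qed

end

section \<open>The nilradical\<close>

lemma lower_central_series_mem_zero:
  assumes "subspace J"
  shows "0 \<in> lower_central_series br J n"
  using assms by (cases n) (simp_all add: bracket_span_def subspace_0 span_0)

locale fd_lie_algebra = lie_algebra br for br :: "'a::real_vector \<Rightarrow> 'a \<Rightarrow> 'a" +
  assumes fd: "finite_dimensional TYPE('a)"
begin

sublocale ad: lie_representation br br
proof
  show "finite_dimensional TYPE('a)" by (rule fd)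
  show "bilinear br" by (rule bilinear_br)
  show "br (br x y) v = br x (br y v) - br y (br x v)" for x y v
    using br_derivation[of x y v] by simp
qed

text \<open>If a nilpotent ideal \<open>J\<close> acted nontrivially on a chief factor, the dichotomy would let every
  vector outside \<open>U\<close> be moved by \<open>J\<close> to another vector outside \<open>U\<close>. Iterating gives nonzero
  elements arbitrarily deep in the lower central series.\<close>

lemma nilpotent_ideal_subset_chief_kernel:
  assumes J: "nilpotent_lie_ideal br J"
  shows "J \<subseteq> ad.chief_kernel"
proof -
  have J_sub: "subspace J" and J_br: "\<And>x y. y \<in> J \<Longrightarrow> br x y \<in> J"
    using J by (auto simp: nilpotent_lie_ideal_def lie_ideal_def)
  obtain n where n: "lower_central_series br J n = {0}"
    using J by (auto simp: nilpotent_lie_ideal_def)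
  have J_br': "br y x \<in> J" if "y \<in> J" for x y
    using subspace_neg[OF J_sub J_br[OF that, of x]] br_skew[of y x] by simp
  have "\<forall>y\<in>J. ad.kills y U W" if UW: "ad.chief_factor U W" for U W
  proof (rule ccontr)
    assume "\<not> ?thesis"
    then have push: "\<exists>y\<in>J. br y w \<notin> U" if "w \<in> W" "w \<notin> U" for w
      using ad.kernel_dichotomy[OF UW, of J] J_br' that by blast
    have inv: "subspace U" "\<And>x w. w \<in> W \<Longrightarrow> br x w \<in> W" "U \<subset> W"
      using UW by (auto simp: ad.chief_factor_def ad.invariant_def)
    have "\<exists>w\<in>W. w \<notin> U \<and> w \<in> lower_central_series br J k" for k
    proof (induction k)
      case 0
      \<comment> \<open>One push already moves the vector into \<open>J\<close>, the initial term of the series.\<close>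
      obtain w where "w \<in> W" "w \<notin> U" using inv by blast
      then show ?case using push[of w] inv J_br' by fastforce
    next
      case (Suc k)
      then obtain w where w: "w \<in> W" "w \<notin> U" "w \<in> lower_central_series br J k" by blast
      then obtain y where y: "y \<in> J" "br y w \<notin> U" using push by blast
      have "br y w \<in> lower_central_series br J (Suc k)"
        using w y by (auto simp: bracket_span_def intro!: span_base)
      then show ?case using y w inv by blast
    qed
    from this[of n] show False using n subspace_0[OF inv(1)] by auto
  qed
  then show ?thesis by (auto simp: ad.chief_kernel_def)
qed

lemma nilpotent_chief_kernel: "nilpotent_lie_ideal br ad.chief_kernel"
proof -
  obtain n where n: "lower_central_series br ad.chief_kernel n \<subseteq> {0}"
    using ad.lower_central_series_reaches_zero[of ad.chief_kernel br]
    by (auto simp: ad.chief_kernel_def ad.kills_def)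
  have "subspace ad.chief_kernel" using ad.chief_kernel_ideal by (simp add: lie_ideal_def)
  then have "lower_central_series br ad.chief_kernel n = {0}"
    using n lower_central_series_mem_zero by blast
  then show ?thesis using ad.chief_kernel_ideal by (auto simp: nilpotent_lie_ideal_def)
qed

lemma nilradical_eq_chief_kernel: "nilradical br = ad.chief_kernel"
  unfolding nilradical_def
  using nilpotent_chief_kernel nilpotent_ideal_subset_chief_kernel by (rule Greatest_equality)

lemma nilradical_ideal: "lie_ideal br (nilradical br)"
  using ad.chief_kernel_ideal by (simp add: nilradical_eq_chief_kernel)

lemma nilradical_upper: "nilpotent_lie_ideal br J \<Longrightarrow> J \<subseteq> nilradical br"
  by (simp add: nilradical_eq_chief_kernel nilpotent_ideal_subset_chief_kernel)

end

section \<open>Derivations of solvable Lie algebras\<close>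

locale lie_derivation = fd_lie_algebra br for br :: "'a::real_vector \<Rightarrow> 'a \<Rightarrow> 'a" +
  fixes D :: "'a \<Rightarrow> 'a"
  assumes linear_D: "linear D"
    and D_br: "D (br x y) = br (D x) y + br x (D y)"
begin

text \<open>The semidirect product of the Lie algebra with a line acting through \<open>D\<close>: the pair \<open>(x, s)\<close>
  stands for the formal sum of \<open>x\<close> and \<open>s D\<close>, and \<open>ext_act\<close> below is its action on the original
  algebra by the derivation \<open>ad x + s D\<close>.\<close>

definition ext_br :: "'a \<times> real \<Rightarrow> 'a \<times> real \<Rightarrow> 'a \<times> real" where
  "ext_br p q = (br (fst p) (fst q) + snd p *\<^sub>R D (fst q) - snd q *\<^sub>R D (fst p), 0)"

definition ext_act :: "'a \<times> real \<Rightarrow> 'a \<Rightarrow> 'a" where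
  "ext_act p v = br (fst p) v + snd p *\<^sub>R D v"

lemmas linear_simps =
  linear_add[OF linear_br_right] linear_add[OF linear_br_left]
  linear_diff[OF linear_br_right] linear_diff[OF linear_br_left]
  linear_scale[OF linear_br_right] linear_scale[OF linear_br_left]
  linear_add[OF linear_D] linear_diff[OF linear_D] linear_scale[OF linear_D]

lemma ext_act_br: "ext_act (ext_br p q) v = ext_act p (ext_act q v) - ext_act q (ext_act p v)"
  using br_derivation[of "fst p" "fst q" v]
  by (simp add: ext_act_def ext_br_def linear_simps D_br algebra_simps)

lemma ext_lie_algebra: "lie_algebra ext_br"
proof
  show "bilinear ext_br"
    unfolding bilinear_def linear_iff ext_br_def
    by (simp add: linear_simps algebra_simps)
  show "ext_br p p = 0" for p
    by (simp add: ext_br_def br_self zero_prod_def)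
  show "ext_br p (ext_br q r) + ext_br q (ext_br r p) + ext_br r (ext_br p q) = 0" for p q r
  proof -
    obtain x s y t z u where [simp]: "p = (x, s)" "q = (y, t)" "r = (z, u)"
      by (metis surj_pair)
    have "br y (D x) = - br (D x) y" "br z (D x) = - br (D x) z" "br x (D y) = - br (D y) x"
      "br z (D y) = - br (D y) z" "br x (D z) = - br (D z) x" "br y (D z) = - br (D z) y"
      by (rule br_skew)+
    then show ?thesis
      using jacobi[of x y z]
      by (simp add: ext_br_def zero_prod_def linear_simps D_br algebra_simps)
  qed
qed

sublocale ext: lie_representation ext_br ext_act
proof -
  interpret lie_algebra ext_br by (rule ext_lie_algebra)
  show "lie_representation ext_br ext_act"
  proof
    show "bilinear ext_act"
      unfolding bilinear_def linear_iff ext_act_def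
      by (simp add: linear_simps algebra_simps)
  qed (simp_all add: fd ext_act_br)
qed

text \<open>The derived ideals lag by one step: the first one only removes the line spanned by \<open>D\<close>.\<close>

lemma ext_derived_series: "derived_series ext_br (Suc n) \<subseteq> derived_series br n \<times> {0}"
proof (induction n)
  case 0
  show ?case
    unfolding derived_series.simps bracket_span_def
    by (rule span_minimal) (auto simp: ext_br_def subspace_def zero_prod_def)
next
  case (Suc n)
  have sub: "subspace (derived_series br (Suc n) \<times> {0::real})"
    by (intro subspace_Times subspace_derived_series subspace_single_0)
  have "ext_br p q \<in> derived_series br (Suc n) \<times> {0}"
    if pq: "p \<in> derived_series ext_br (Suc n)" "q \<in> derived_series ext_br (Suc n)" for p q
  proof -
    obtain u v where "p = (u, 0)" "q = (v, 0)" "u \<in> derived_series br n" "v \<in> derived_series br n"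
      using subsetD[OF Suc pq(1)] subsetD[OF Suc pq(2)] by auto
    then show ?thesis by (simp add: ext_br_def br_mem_derived_series del: derived_series.simps(2))
  qed
  then have "{ext_br p q |p q. p \<in> derived_series ext_br (Suc n) \<and> q \<in> derived_series ext_br (Suc n)}
      \<subseteq> derived_series br (Suc n) \<times> {0}"
    by blast
  from span_minimal[OF this sub] show ?case
    by (simp only: derived_series.simps(2)[of ext_br "Suc n"] bracket_span_def[of ext_br "derived_series ext_br (Suc n)"])
qed

lemma ext_solvable:
  assumes "solvable_lie br"
  shows "solvable_lie ext_br"
proof -
  obtain n where "derived_series br n = {0}" using assms by (auto simp: solvable_lie_def)
  then have "derived_series ext_br (Suc n) \<subseteq> {0}"
    using ext_derived_series[of n] by (auto simp: zero_prod_def)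
  then have "derived_series ext_br (Suc n) = {0}"
    using subspace_0[OF ext.subspace_derived_series[of "Suc n"]] by blast
  then show ?thesis unfolding solvable_lie_def by blast
qed

text \<open>The adjoint action of \<open>x\<close> is the action of \<open>(x, 0)\<close>, so the elements of this ideal lower the
  chief factors of the semidirect product. Those factors are ideals stable under \<open>D\<close> and need not
  be chief factors of the adjoint representation.\<close>

lemma nilpotent_ext_kernel: "nilpotent_lie_ideal br {x. (x, 0) \<in> ext.chief_kernel}"
proof -
  let ?J = "{x. (x, 0) \<in> ext.chief_kernel}"
  have K: "subspace ext.chief_kernel" "\<And>p q. q \<in> ext.chief_kernel \<Longrightarrow> ext_br p q \<in> ext.chief_kernel"
    using ext.chief_kernel_ideal by (auto simp: lie_ideal_def)
  have J: "subspace ?J"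
    unfolding subspace_def
  proof (intro conjI ballI allI)
    show "0 \<in> ?J" using subspace_0[OF K(1)] by (simp add: zero_prod_def)
    show "x + y \<in> ?J" if "x \<in> ?J" "y \<in> ?J" for x y
      using that subspace_add[OF K(1), of "(x, 0)" "(y, 0)"] by simp
    show "c *\<^sub>R x \<in> ?J" if "x \<in> ?J" for c x
      using that subspace_scale[OF K(1), of "(x, 0)" c] by simp
  qed
  have "br x y \<in> ?J" if "y \<in> ?J" for x y
    using that K(2)[of "(y, 0)" "(x, 0)"] by (simp add: ext_br_def)
  then have ideal: "lie_ideal br ?J" using J by (simp add: lie_ideal_def)
  obtain n where "lower_central_series br ?J n \<subseteq> {0}"
    using ext.lower_central_series_reaches_zero[of ?J br]
    by (auto simp: ext.chief_kernel_def ext.kills_def ext_act_def)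
  then have "lower_central_series br ?J n = {0}"
    using lower_central_series_mem_zero[OF J] by blast
  then show ?thesis using ideal by (auto simp: nilpotent_lie_ideal_def)
qed

text \<open>In the semidirect product, \<open>D x\<close> is the bracket of the generator \<open>(0, 1)\<close> of the line with
  \<open>(x, 0)\<close>.\<close>

theorem derivation_into_nilradical:
  assumes "solvable_lie br"
  shows "D x \<in> nilradical br"
proof -
  have "ext_br (0, 1) (x, 0) \<in> ext.chief_kernel"
    by (rule ext.solvable_bracket_in_chief_kernel[OF ext_solvable[OF assms]])
  then have "D x \<in> {x. (x, 0) \<in> ext.chief_kernel}"
    by (simp add: ext_br_def linear_0[OF linear_br_left])
  then show ?thesis using nilradical_upper[OF nilpotent_ext_kernel] by blast
qed

end

theorem proposition3p1:
  fixes dot circ tri :: "'a::real_vector \<Rightarrow> 'a \<Rightarrow> 'a"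
  assumes "post_lie_algebra dot circ tri"
    and "solvable_lie dot"
  shows "post_lie_ideal dot tri (nilradical dot)"
proof -
  interpret post_lie_algebra dot circ tri by (rule assms(1))
  interpret fd_lie_algebra dot by unfold_locales (rule finite_dim)
  have "tri x y \<in> nilradical dot" for x y
  proof -
    interpret lie_derivation dot "tri x"
    proof (intro lie_derivation.intro lie_derivation_axioms.intro fd_lie_algebra_axioms)
      show "linear (tri x)" using bilinear_tri by (simp add: bilinear_def)
    qed (rule tri_dot)
    show ?thesis by (rule derivation_into_nilradical[OF assms(2)])
  qed
  then show ?thesis
    using nilradical_ideal by (simp add: post_lie_ideal_def lie_ideal_def)
qed

end
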